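(* Let $(u(x-ct,y),v(x-ct,y))$, with profile $(u,v)\in C^2(D_L^\infty)$ and arbitrary wave speed $c\in\mathbb R$, be a traveling-wave solution of the $\beta$-plane equation in the unbounded channel $D_L^\infty=\mathbb T_L\times\mathbb R$ with $v\to0$ as $y\to\pm\infty$ for $x\in\mathbb T_L$. Assume that $\partial_xv,\partial_yv,\Delta v\in L^\infty(D_L^\infty)$, that $v\,\partial_yu\to0$ as $y\to\pm\infty$ for $x\in\mathbb T_L$, and that one of the following conditions holds: (i) $(\Delta u)_{\inf}>0$ and $\beta\in(0,(\Delta u)_{\inf})$; (ii) $\beta=0$ and $0\notin\overline{\mathrm{Ran}(\Delta u)}$. Then $(u(x-ct,y),v(x-ct,y))$ is a shear flow.
   Context: Let $L>0$, $\mathbb T_L=\mathbb R/L\mathbb Z$, $D_L^\infty=\mathbb T_L\times(-\infty,\infty)$. For a constant $\beta\ge0$, the $\beta$-plane equation on $D_L^\infty$ is $$u_t+uu_x+vu_y-\beta yv=-P_x,\quad v_t+uv_x+vv_y+\beta yu=-P_y,\quad u_x+v_y=0$$ ($P$ is the pressure), with the asymptotic condition $v\to0$ as $y\to\pm\infty$ for $x\in\mathbb T_L$. A traveling-wave solution of speed $c\in\mathbb R$ is a solution (for some pressure) of the form $(u(x-ct,y),v(x-ct,y))$, with profiles $u,v$ defined on $D_L^\infty$ ($L$-periodic in the first variable). It is a shear flow if $v\equiv0$ on $D_L^\infty$ (so that $u$ depends only on $y$). For a function $f$ on $D_L^\infty$, $f_{\inf}=\inf_{D_L^\infty}f$ and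 $\mathrm{Ran}(f)$ is its range; $\Delta=\partial_x^2+\partial_y^2$. *)

theory Defs
  imports "HOL-Analysis.Analysis"
begin

text \<open>
  Functions on \<open>D = (\<real>/L\<int>) \<times> \<real>\<close> are represented by their lifts to \<open>\<real> \<times> \<real>\<close>, i.e. by curried
  functions of \<open>(x, y)\<close> that are \<open>L\<close>-periodic in \<open>x\<close>.
\<close>

definition x_periodic :: "real \<Rightarrow> (real \<Rightarrow> real \<Rightarrow> real) \<Rightarrow> bool" where
  "x_periodic L f \<longleftrightarrow> (\<forall>x y. f (x + L) y = f x y)"

definition dx :: "(real \<Rightarrow> real \<Rightarrow> real) \<Rightarrow> real \<Rightarrow> real \<Rightarrow> real" where
  "dx f x y = deriv (\<lambda>s. f s y) x"

definition dy :: "(real \<Rightarrow> real \<Rightarrow> real) \<Rightarrow> real \<Rightarrow> real \<Rightarrow> real" where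
  "dy f x y = deriv (\<lambda>s. f x s) y"

definition laplacian :: "(real \<Rightarrow> real \<Rightarrow> real) \<Rightarrow> real \<Rightarrow> real \<Rightarrow> real" where
  "laplacian f x y = dx (dx f) x y + dy (dy f) x y"

definition partially_differentiable :: "(real \<Rightarrow> real \<Rightarrow> real) \<Rightarrow> bool" where
  "partially_differentiable f \<longleftrightarrow>
     (\<forall>x y. (\<lambda>s. f s y) differentiable at x \<and> (\<lambda>s. f x s) differentiable at y)"

text \<open>\<open>Ck k f\<close>: all partial derivatives of \<open>f\<close> up to order \<open>k\<close> exist and are jointly continuous.\<close>

fun Ck :: "nat \<Rightarrow> (real \<Rightarrow> real \<Rightarrow> real) \<Rightarrow> bool" where
  "Ck 0 f \<longleftrightarrow> continuous_on UNIV (\<lambda>(x, y). f x y)"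
| "Ck (Suc k) f \<longleftrightarrow> continuous_on UNIV (\<lambda>(x, y). f x y) \<and> partially_differentiable f
      \<and> Ck k (dx f) \<and> Ck k (dy f)"

text \<open>For periodic functions, essential boundedness over one period and over the plane agree.\<close>

definition in_Linfty :: "(real \<Rightarrow> real \<Rightarrow> real) \<Rightarrow> bool" where
  "in_Linfty f \<longleftrightarrow> (\<lambda>(x, y). f x y) \<in> borel_measurable lebesgue
     \<and> (\<exists>C. AE (x, y) in lebesgue. \<bar>f x y\<bar> \<le> C)"

text \<open>
  Classical solutions; the arguments of \<open>U\<close>, \<open>V\<close> and the pressure \<open>P\<close> are \<open>t\<close>, \<open>x\<close>, \<open>y\<close> in this
  order. The decay of \<open>V\<close> as \<open>y \<rightarrow> \<plusminus>\<infinity>\<close> is not part of this predicate.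
\<close>

definition beta_plane_solution ::
  "real \<Rightarrow> real \<Rightarrow> (real \<Rightarrow> real \<Rightarrow> real \<Rightarrow> real) \<Rightarrow> (real \<Rightarrow> real \<Rightarrow> real \<Rightarrow> real)
     \<Rightarrow> (real \<Rightarrow> real \<Rightarrow> real \<Rightarrow> real) \<Rightarrow> bool" where
  "beta_plane_solution L \<beta> U V P \<longleftrightarrow>
     (\<forall>t. x_periodic L (U t) \<and> x_periodic L (V t) \<and> x_periodic L (P t)) \<and>
     (\<forall>t. partially_differentiable (U t) \<and> partially_differentiable (V t)
          \<and> partially_differentiable (P t)) \<and>
     (\<forall>t x y. (\<lambda>s. U s x y) differentiable at t \<and> (\<lambda>s. V s x y) differentiable at t) \<and>
     (\<forall>t x y.
        deriv (\<lambda>s. U s x y) t + U t x y * dx (U t) x y + V t x y * dy (U t) x y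
          - \<beta> * y * V t x y = - dx (P t) x y \<and>
        deriv (\<lambda>s. V s x y) t + U t x y * dx (V t) x y + V t x y * dy (V t) x y
          + \<beta> * y * U t x y = - dy (P t) x y \<and>
        dx (U t) x y + dy (V t) x y = 0)"

definition traveling_wave ::
  "real \<Rightarrow> real \<Rightarrow> real \<Rightarrow> (real \<Rightarrow> real \<Rightarrow> real) \<Rightarrow> (real \<Rightarrow> real \<Rightarrow> real) \<Rightarrow> bool" where
  "traveling_wave L \<beta> c u v \<longleftrightarrow>
     (\<exists>P. beta_plane_solution L \<beta> (\<lambda>t x y. u (x - c * t) y) (\<lambda>t x y. v (x - c * t) y) P)"

definition decays_in_y :: "(real \<Rightarrow> real \<Rightarrow> real) \<Rightarrow> bool" where
  "decays_in_y f \<longleftrightarrow> (\<forall>x. ((\<lambda>y. f x y) \<longlongrightarrow> 0) at_top \<and> ((\<lambda>y. f x y) \<longlongrightarrow> 0) at_bot)"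

text \<open>That \<open>u\<close> depends on \<open>y\<close> only then follows from incompressibility.\<close>

definition shear_flow :: "(real \<Rightarrow> real \<Rightarrow> real) \<Rightarrow> (real \<Rightarrow> real \<Rightarrow> real) \<Rightarrow> bool" where
  "shear_flow u v \<longleftrightarrow> (\<forall>x y. v x y = 0)"

text \<open>The infimum is taken in the extended reals, so it is \<open>-\<infinity>\<close> for \<open>f\<close> unbounded below.\<close>

definition inf_val :: "(real \<Rightarrow> real \<Rightarrow> real) \<Rightarrow> ereal" where
  "inf_val f = (INF (x, y)\<in>UNIV. ereal (f x y))"

definition Ran :: "(real \<Rightarrow> real \<Rightarrow> real) \<Rightarrow> real set" where
  "Ran f = range (\<lambda>(x, y). f x y)"

end

theory Submission
  imports Defs
begin

text \<open>
  Eliminating the pressure gives (u - c) \<Delta>v = v (\<Delta>u - \<beta>). Up to a common sign of (u - c, v), which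
  can be changed when \<beta> = 0, this reads U \<Delta>V = V (\<Delta>U - \<beta>) with \<Delta>U \<ge> \<beta> + \<delta> for some \<delta> > 0. The maximum
  principle yields U < 0 wherever V is nonzero. As \<Delta>U \<ge> \<delta> and the oscillation of U in x is bounded
  (U_x = - V_y), U grows to infinity as y tends to infinity in both directions. If V is not
  identically zero, take the highest and lowest points of {U \<le> 0}. Beyond them V = 0, so U does not
  depend on x and both points lie on full horizontal lines on which U \<le> 0 and V = V_y = 0. In the strip
  between these lines U < 0 by the maximum principle, with at least linear decay at the boundary,
  so V / U tends to 0 there. Since div (U^2 grad (V / U)) = - \<beta> V, the maximum principle
  applied to V / U gives V = 0 in the strip, a contradiction.
\<close>

section \<open>Second derivatives at a local maximum\<close>

text \<open>Carrying the derivatives as explicit functions lets reflected, scaled and perturbed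
  functions be treated uniformly. Only pure second derivatives are recorded, since maxima are tested
  along coordinate lines.\<close>

definition pure_partials ::
  "(real \<Rightarrow> real \<Rightarrow> real) \<Rightarrow> (real \<Rightarrow> real \<Rightarrow> real) \<Rightarrow> (real \<Rightarrow> real \<Rightarrow> real)
    \<Rightarrow> (real \<Rightarrow> real \<Rightarrow> real) \<Rightarrow> (real \<Rightarrow> real \<Rightarrow> real) \<Rightarrow> bool" where
  "pure_partials f fx fy fxx fyy \<longleftrightarrow> (\<forall>x y.
     ((\<lambda>s. f s y) has_real_derivative fx x y) (at x) \<and>
     ((\<lambda>s. f x s) has_real_derivative fy x y) (at y) \<and>
     ((\<lambda>s. fx s y) has_real_derivative fxx x y) (at x) \<and>
     ((\<lambda>s. fy x s) has_real_derivative fyy x y) (at y))"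

lemma pure_partialsD:
  assumes "pure_partials f fx fy fxx fyy"
  shows "((\<lambda>s. f s y) has_real_derivative fx x y) (at x)"
    and "((\<lambda>s. f x s) has_real_derivative fy x y) (at y)"
    and "((\<lambda>s. fx s y) has_real_derivative fxx x y) (at x)"
    and "((\<lambda>s. fy x s) has_real_derivative fyy x y) (at y)"
  using assms unfolding pure_partials_def by blast+

text \<open>The Laplacian is invariant under y -> -y, so results about large y transfer to y tending
  to -infinity.\<close>

lemma pure_partials_reflect:
  assumes "pure_partials f fx fy fxx fyy"
  shows "pure_partials (\<lambda>x y. f x (- y)) (\<lambda>x y. fx x (- y)) (\<lambda>x y. - fy x (- y))
           (\<lambda>x y. fxx x (- y)) (\<lambda>x y. fyy x (- y))"
  unfolding pure_partials_def
proof (intro allI conjI)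
  fix x y
  show "((\<lambda>s. f s (- y)) has_real_derivative fx x (- y)) (at x)"
    and "((\<lambda>s. fx s (- y)) has_real_derivative fxx x (- y)) (at x)"
    using pure_partialsD[OF assms] by auto
  have m: "((\<lambda>s::real. - s) has_real_derivative - 1) (at y)"
    by (auto intro!: derivative_eq_intros)
  show "((\<lambda>s. f x (- s)) has_real_derivative - fy x (- y)) (at y)"
    using DERIV_chain2[OF pure_partialsD(2)[OF assms] m] by simp
  show "((\<lambda>s. - fy x (- s)) has_real_derivative fyy x (- y)) (at y)"
    using DERIV_minus[OF DERIV_chain2[OF pure_partialsD(4)[OF assms] m]] by simp
qed

text \<open>Serves to pass to the moving frame, with \<open>c\<close> the wave speed, and to change
  signs.\<close>

lemma pure_partials_scale:
  assumes "pure_partials f fx fy fxx fyy"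
  shows "pure_partials (\<lambda>x y. s * (f x y - c)) (\<lambda>x y. s * fx x y) (\<lambda>x y. s * fy x y)
           (\<lambda>x y. s * fxx x y) (\<lambda>x y. s * fyy x y)"
  unfolding pure_partials_def
  by (intro allI conjI; (rule derivative_eq_intros pure_partialsD[OF assms] refl | simp)+)

text \<open>If \<open>D\<close> were positive, then \<open>f1\<close>, which vanishes at the
  maximum, would be positive just to its right, and the mean value theorem would give larger values
  of \<open>f\<close> there.\<close>

lemma local_max_second_deriv_nonpos:
  fixes f :: "real \<Rightarrow> real"
  assumes f1: "\<And>t. (f has_real_derivative f1 t) (at t)"
    and f2: "(f1 has_real_derivative D) (at x)"
    and e: "0 < e" and mx: "\<And>t. \<bar>t - x\<bar> < e \<Longrightarrow> f t \<le> f x"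
  shows "D \<le> 0"
proof (rule ccontr)
  assume "\<not> D \<le> 0"
  then obtain d where d: "d > 0" "\<And>h. 0 < h \<Longrightarrow> h < d \<Longrightarrow> f1 x < f1 (x + h)"
    using DERIV_pos_inc_right[OF f2] by auto
  have f1x: "f1 x = 0"
    using DERIV_local_max[OF f1 e] mx by (simp add: abs_minus_commute)
  define h where "h = min d e / 2"
  have h: "0 < h" "h < d" "h < e" using d e by (auto simp: h_def)
  obtain z where z: "x < z" "z < x + h" "f (x + h) - f x = (x + h - x) * f1 z"
    using MVT2[of x "x + h" f f1] f1 h by auto
  have "f1 z > 0" using d(2)[of "z - x"] z h f1x by auto
  then have "f (x + h) > f x" using z h by (simp add: algebra_simps)
  with mx[of "x + h"] h show False by auto
qed

lemma laplacian_nonpos_at_local_max: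
  assumes Z: "pure_partials Z Zx Zy Zxx Zyy"
    and S: "open S" "(x, y) \<in> S" and mx: "\<And>a b. (a, b) \<in> S \<Longrightarrow> Z a b \<le> Z x y"
  shows "Zxx x y + Zyy x y \<le> 0"
proof -
  obtain e where e: "e > 0" "ball (x, y) e \<subseteq> S"
    using S by (meson open_contains_ball)
  have "Zxx x y \<le> 0"
  proof (rule local_max_second_deriv_nonpos[of "\<lambda>s. Z s y" "\<lambda>s. Zx s y"])
    fix t assume "\<bar>t - x\<bar> < e"
    then have "(t, y) \<in> ball (x, y) e" by (simp add: dist_Pair_Pair dist_real_def abs_minus_commute)
    then show "Z t y \<le> Z x y" using e mx by blast
  qed (use e pure_partialsD[OF Z] in auto)
  moreover have "Zyy x y \<le> 0"
  proof (rule local_max_second_deriv_nonpos[of "\<lambda>s. Z x s" "\<lambda>s. Zy x s"])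
    fix t assume "\<bar>t - y\<bar> < e"
    then have "(x, t) \<in> ball (x, y) e" by (simp add: dist_Pair_Pair dist_real_def abs_minus_commute)
    then show "Z x t \<le> Z x y" using e mx by blast
  qed (use e pure_partialsD[OF Z] in auto)
  ultimately show ?thesis by simp
qed

section \<open>Maxima of periodic functions\<close>

lemma x_periodic_int:
  assumes "x_periodic L f"
  shows "f (x + of_int n * L) y = f x y"
proof -
  have nat: "f (x + of_nat m * L) y = f x y" for m x
  proof (induction m)
    case (Suc m)
    have "f (x + of_nat (Suc m) * L) y = f ((x + of_nat m * L) + L) y" by (simp add: algebra_simps)
    then show ?case using Suc assms by (simp add: x_periodic_def)
  qed simp
  show ?thesis
  proof (cases "n \<ge> 0")
    case True
    then show ?thesis using nat[of x "nat n"] by simp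
  next
    case False
    then show ?thesis using nat[of "x + of_int n * L" "nat (- n)"] by simp
  qed
qed

lemma x_periodic_shift:
  fixes L x :: real
  assumes "L > 0"
  obtains n :: int where "0 \<le> x + of_int n * L" "x + of_int n * L \<le> L"
proof
  have "of_int \<lfloor>x / L\<rfloor> * L \<le> (x / L) * L" "(x / L) * L \<le> (of_int \<lfloor>x / L\<rfloor> + 1) * L"
    using assms by (intro mult_right_mono; linarith)+
  then show "0 \<le> x + of_int (- \<lfloor>x / L\<rfloor>) * L" "x + of_int (- \<lfloor>x / L\<rfloor>) * L \<le> L"
    using assms by (simp_all add: algebra_simps)
qed

text \<open>Translation by periods moves every point of \<open>E\<close> into the compact part of
  \<open>E\<close> with x in [0, L]. A maximum over this part is a maximum over all of
  \<open>E\<close>.\<close>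

lemma periodic_attains_sup:
  fixes F :: "real \<Rightarrow> real \<Rightarrow> real"
  assumes L: "L > 0" and E: "closed E" "(x0, y0) \<in> E"
    and Eper: "\<And>x y n. (x, y) \<in> E \<Longrightarrow> (x + of_int n * L, y) \<in> E"
    and Ebd: "\<And>x y. (x, y) \<in> E \<Longrightarrow> \<bar>y\<bar> \<le> R"
    and F: "continuous_on E (\<lambda>(x, y). F x y)" and Fper: "x_periodic L F"
  obtains a b where "(a, b) \<in> E" "\<And>x y. (x, y) \<in> E \<Longrightarrow> F x y \<le> F a b"
proof -
  let ?K = "E \<inter> cbox (0, - R) (L, R)"
  have red: "\<exists>n::int. (x + of_int n * L, y) \<in> ?K" if "(x, y) \<in> E" for x y
  proof -
    obtain n :: int where "0 \<le> x + of_int n * L" "x + of_int n * L \<le> L"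
      using x_periodic_shift[OF L] .
    then show ?thesis using Eper[OF that, of n] Ebd[OF that] by (auto intro!: exI[of _ n])
  qed
  have "compact ?K" "?K \<noteq> {}"
    using E red[OF E(2)] by (auto intro: closed_Int_compact)
  moreover have "continuous_on ?K (\<lambda>(x, y). F x y)" using F by (rule continuous_on_subset) auto
  ultimately obtain p where p: "p \<in> ?K" "\<And>q. q \<in> ?K \<Longrightarrow> (case q of (x, y) \<Rightarrow> F x y) \<le> (case p of (x, y) \<Rightarrow> F x y)"
    using continuous_attains_sup[of ?K "\<lambda>(x, y). F x y"] by blast
  obtain a b where ab: "p = (a, b)" by force
  show ?thesis
  proof
    show "(a, b) \<in> E" using p ab by auto
    fix x y assume "(x, y) \<in> E"
    then obtain n :: int where "(x + of_int n * L, y) \<in> ?K" using red by blast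
    from p(2)[OF this] show "F x y \<le> F a b" using x_periodic_int[OF Fper] ab by simp
  qed
qed

lemma closed_le_fun:
  fixes f g :: "real \<Rightarrow> real \<Rightarrow> real"
  assumes "continuous_on UNIV (\<lambda>(x, y). f x y)" "continuous_on UNIV (\<lambda>(x, y). g x y)"
  shows "closed {(x, y). f x y \<le> g x y}"
  using closed_Collect_le[OF assms] by (simp add: case_prod_unfold)

section \<open>Maximum principle on strips and growth at infinity\<close>

text \<open>A positive Laplacian excludes a maximum inside the strip, so the maximum over the closed
  strip lies on the boundary lines.\<close>

lemma strip_max_principle:
  assumes L: "L > 0" and per: "x_periodic L Z"
    and cont: "continuous_on UNIV (\<lambda>(x, y). Z x y)"
    and Z: "pure_partials Z Zx Zy Zxx Zyy"
    and lap: "\<And>x y. a < y \<Longrightarrow> y < b \<Longrightarrow> Zxx x y + Zyy x y > 0"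
    and bd: "\<And>x. Z x a \<le> 0" "\<And>x. Z x b \<le> 0"
    and y: "a < y" "y < b"
  shows "Z x y < 0"
proof (rule ccontr)
  assume neg: "\<not> Z x y < 0"
  let ?E = "UNIV \<times> {a..b} :: (real \<times> real) set"
  have noint: False if mx: "\<And>s t. (s, t) \<in> ?E \<Longrightarrow> Z s t \<le> Z p q" and q: "a < q" "q < b" for p q
  proof -
    have "Zxx p q + Zyy p q \<le> 0"
    proof (rule laplacian_nonpos_at_local_max[OF Z])
      show "open (UNIV \<times> {a<..<b} :: (real \<times> real) set)" by (intro open_Times) auto
    qed (use mx q in auto)
    with lap[OF q, of p] show False by simp
  qed
  obtain p q where pq: "(p, q) \<in> ?E" "\<And>s t. (s, t) \<in> ?E \<Longrightarrow> Z s t \<le> Z p q"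
  proof (rule periodic_attains_sup[OF L, of ?E x y "max \<bar>a\<bar> \<bar>b\<bar>" Z])
    show "closed ?E" by (intro closed_Times) auto
    show "continuous_on ?E (\<lambda>(x, y). Z x y)" using cont by (rule continuous_on_subset) auto
  qed (use y per in auto)
  show False
  proof (cases "a < q \<and> q < b")
    case True
    then show False using noint[OF pq(2)] by blast
  next
    case False
    then have "q = a \<or> q = b" using pq(1) by auto
    then have "Z p q \<le> 0" using bd by auto
    \<comment> \<open>The maximum is at most 0, so the interior point \<open>(x, y)\<close>, where
      \<open>Z\<close> is assumed nonnegative, attains it as well. This is what makes the conclusion
      strict.\<close>
    then have "\<And>s t. (s, t) \<in> ?E \<Longrightarrow> Z s t \<le> Z x y" using pq(2) neg by fastforce
    then show False using noint y by blast
  qed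
qed

text \<open>Mean value theorem between 0 and the translate of \<open>x\<close> by periods that lies
  in [0, L].\<close>

lemma x_oscillation_bound:
  assumes L: "L > 0" and per: "x_periodic L U"
    and U: "\<And>x y. ((\<lambda>s. U s y) has_real_derivative Ux x y) (at x)"
    and B: "\<And>x y. \<bar>Ux x y\<bar> \<le> B"
  shows "\<bar>U x y - U 0 y\<bar> \<le> B * L"
proof -
  obtain n :: int where n: "0 \<le> x + of_int n * L" "x + of_int n * L \<le> L"
    using x_periodic_shift[OF L] .
  have B0: "B \<ge> 0" using B[of 0 0] by linarith
  have "norm (U (x + of_int n * L) y - U 0 y) \<le> B * norm (x + of_int n * L - 0)"
    by (rule field_differentiable_bound[of UNIV "\<lambda>s. U s y" "\<lambda>s. Ux s y"])
      (use U B in auto)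
  also have "\<dots> \<le> B * L" using n B0 by (intro mult_left_mono) auto
  finally show ?thesis using x_periodic_int[OF per] by simp
qed

text \<open>Comparing U on the strip between the lines at -1 and Y with a quadratic polynomial in y
  and evaluating at the origin bounds U from below on the line at Y.\<close>
lemma subharmonic_pos_at_top:
  assumes L: "L > 0" and per: "x_periodic L U"
    and cont: "continuous_on UNIV (\<lambda>(x, y). U x y)"
    and U: "pure_partials U Ux Uy Uxx Uyy"
    and lap: "\<And>x y. Uxx x y + Uyy x y \<ge> \<delta>" and \<delta>: "\<delta> > 0"
    and B: "\<And>x y. \<bar>Ux x y\<bar> \<le> B"
  obtains R where "\<And>x y. y \<ge> R \<Longrightarrow> U x y > 0"
proof -
  define K where "K = B * L"
  have osc: "\<bar>U x y - U 0 y\<bar> \<le> K" for x y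
    unfolding K_def by (rule x_oscillation_bound[OF L per pure_partialsD(1)[OF U] B])
  define A where "A = U 0 (- 1) + K"
  have low: "(1 + Y) * (U 0 0 + \<delta> / 4 * Y) - A * Y < U 0 Y + K" if Y: "Y > 0" for Y
  proof -
    \<comment> \<open>The affine function \<open>A + m * (y + 1)\<close> equals \<open>A\<close> at
      -1 and \<open>U 0 Y + K\<close> at \<open>Y\<close>, hence dominates \<open>U\<close> on both
      lines by the oscillation bound. The quadratic term in \<open>Z\<close> vanishes on both lines
      and has Laplacian \<open>\<delta> / 2\<close>, which leaves \<open>Z\<close> strictly
      subharmonic.\<close>
    define m where "m = (U 0 Y + K - A) / (1 + Y)"
    have m: "m * (1 + Y) = U 0 Y + K - A" using Y by (simp add: m_def)
    define Z where "Z = (\<lambda>x y. U x y - \<delta> / 4 * ((y + 1) * (y - Y)) - (A + m * (y + 1)))"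
    have "Z 0 0 < 0"
    proof (rule strip_max_principle[OF L, of Z Ux "\<lambda>x y. Uy x y - \<delta> / 4 * (2 * y + 1 - Y) - m"
          Uxx "\<lambda>x y. Uyy x y - \<delta> / 2" "- 1" Y])
      show "x_periodic L Z" using per by (simp add: x_periodic_def Z_def)
      show "continuous_on UNIV (\<lambda>(x, y). Z x y)"
        using cont unfolding Z_def case_prod_unfold by (intro continuous_intros)
      show "pure_partials Z Ux (\<lambda>x y. Uy x y - \<delta> / 4 * (2 * y + 1 - Y) - m)
          Uxx (\<lambda>x y. Uyy x y - \<delta> / 2)"
        unfolding pure_partials_def Z_def
        by (intro allI conjI; (rule derivative_eq_intros pure_partialsD[OF U] refl | simp add: algebra_simps)+)
      show "Uxx x y + (Uyy x y - \<delta> / 2) > 0" for x y using lap[of x y] \<delta> by linarith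
      show "Z x (- 1) \<le> 0" for x using osc[of x "- 1"] by (simp add: Z_def A_def)
      show "Z x Y \<le> 0" for x using osc[of x Y] m by (simp add: Z_def algebra_simps)
    qed (use Y in auto)
    then have "U 0 0 + \<delta> / 4 * Y < A + m" by (simp add: Z_def algebra_simps)
    then have "(1 + Y) * (U 0 0 + \<delta> / 4 * Y) < (1 + Y) * (A + m)" using Y by (intro mult_strict_left_mono) auto
    then show ?thesis using m by (simp add: algebra_simps)
  qed
  \<comment> \<open>In \<open>low\<close> the term quadratic in \<open>Y\<close> has to beat the
    others. Nonnegative bounds \<open>k\<close>, \<open>e\<close>, \<open>a\<close> for
    \<open>K\<close>, \<open>- U 0 0\<close>, \<open>A\<close> avoid sign distinctions, and beyond
    \<open>R\<close> one has \<open>\<delta> / 4 * y \<ge> 2 * e + a + 2 * k\<close>. This forces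
    \<open>U 0 y > K\<close>, so \<open>U\<close> is positive on the whole line.\<close>
  define k where "k = max K 0"
  define e where "e = max (- U 0 0) 0"
  define a where "a = max A 0"
  define R where "R = max 1 (4 / \<delta> * (2 * e + a + 2 * k))"
  have nn: "k \<ge> K" "k \<ge> 0" "e \<ge> - U 0 0" "e \<ge> 0" "a \<ge> A" "a \<ge> 0" by (auto simp: k_def e_def a_def)
  show ?thesis
  proof
    fix x y assume y: "y \<ge> R"
    then have y1: "y \<ge> 1" and "y \<ge> 4 / \<delta> * (2 * e + a + 2 * k)" by (auto simp: R_def)
    then have "\<delta> / 4 * y \<ge> 2 * e + a + 2 * k" using \<delta> by (simp add: field_simps)
    then have "y * (\<delta> / 4 * y) \<ge> y * (2 * e + a + 2 * k)"
      using y1 by (intro mult_left_mono) auto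
    then have "\<delta> / 4 * (y * y) \<ge> 2 * (y * e) + y * a + 2 * (y * k)"
      by (simp add: algebra_simps)
    moreover have "y * k \<ge> 1 * k" "y * a \<ge> y * A" "y * e \<ge> 1 * e" "y * U 0 0 \<ge> y * (- e)"
      using y1 nn by (intro mult_right_mono mult_left_mono; simp)+
    moreover have "\<delta> / 4 * y > 0" using \<delta> y1 by simp
    ultimately have "U 0 0 + \<delta> / 4 * y + y * U 0 0 + \<delta> / 4 * (y * y) - y * A > 2 * K"
      using nn by (simp only: mult_1_left mult_minus_right)
    then have "(1 + y) * (U 0 0 + \<delta> / 4 * y) - A * y > 2 * K"
      by (simp add: algebra_simps add_divide_distrib)
    then show "U x y > 0" using low[of y] y1 osc[of x y] by linarith
  qed
qed

section \<open>Highest line on which U is nonpositive\<close>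

text \<open>\<open>T\<close> is the height of the highest point with U \<le> 0. Above it U > 0, so V
  and its y-derivative vanish, and by incompressibility U is independent of x there. Continuity from
  above carries all this to the line at \<open>T\<close>.\<close>

lemma vanishing_top_line:
  assumes L: "L > 0" and perU: "x_periodic L U"
    and contU: "continuous_on UNIV (\<lambda>(x, y). U x y)"
    and contV: "continuous_on UNIV (\<lambda>(x, y). V x y)"
    and contVy: "continuous_on UNIV (\<lambda>(x, y). Vy x y)"
    and U: "\<And>x y. ((\<lambda>s. U s y) has_real_derivative - Vy x y) (at x)"
    and V: "\<And>x y. ((\<lambda>s. V x s) has_real_derivative Vy x y) (at y)"
    and VU: "\<And>x y. V x y \<noteq> 0 \<Longrightarrow> U x y < 0"
    and top: "\<And>x y. y \<ge> R \<Longrightarrow> U x y > 0"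
    and p: "U px py \<le> 0"
  obtains T where "py \<le> T" "\<And>x. U x T \<le> 0" "\<And>x. V x T = 0" "\<And>x. Vy x T = 0"
proof -
  \<comment> \<open>The half plane bounds the set from below, and \<open>top\<close> bounds it from
    above.\<close>
  let ?E = "{(x, y). U x y \<le> 0} \<inter> UNIV \<times> {py..}"
  obtain a T where aT: "(a, T) \<in> ?E" "\<And>x y. (x, y) \<in> ?E \<Longrightarrow> y \<le> T"
  proof (rule periodic_attains_sup[OF L, of ?E px py "max \<bar>py\<bar> \<bar>R\<bar>" "\<lambda>x y. y"])
    show "closed ?E"
      by (intro closed_Int closed_Times closed_le_fun contU) (auto simp: case_prod_unfold)
    show "(x, y) \<in> ?E \<Longrightarrow> (x + of_int n * L, y) \<in> ?E" for x y n
      using x_periodic_int[OF perU] by auto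
    show "(x, y) \<in> ?E \<Longrightarrow> \<bar>y\<bar> \<le> max \<bar>py\<bar> \<bar>R\<bar>" for x y
      using top[where x=x and y=y] by (cases "R \<le> y") auto
  qed (use p in \<open>auto simp: x_periodic_def case_prod_unfold intro!: continuous_intros\<close>)
  have pos: "U x y > 0" if "y > T" for x y
  proof (rule ccontr)
    assume "\<not> U x y > 0"
    then have "(x, y) \<in> ?E" using that aT(1) by auto
    from aT(2)[OF this] that show False by simp
  qed
  have V0: "V x y = 0" if "y > T" for x y using pos[OF that, of x] VU[of x y] by linarith
  have cy: "continuous_on UNIV (\<lambda>s. f x s)" if "continuous_on UNIV (\<lambda>(x, y). f x y)"
    for f :: "real \<Rightarrow> real \<Rightarrow> real" and x
  proof -
    have "continuous_on UNIV (\<lambda>s::real. (x, s))" by (intro continuous_intros)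
    from continuous_on_compose2[OF that this] show ?thesis by simp
  qed
  have lim: "f T = 0" if "continuous_on UNIV f" "\<And>y. y > T \<Longrightarrow> f y = 0" for f :: "real \<Rightarrow> real"
    by (rule continuous_constant_on_closure[of "{T<..}" f 0 T])
      (use that continuous_on_subset[of UNIV f] in auto)
  have Vy0: "Vy x y = 0" if "y > T" for x y
  proof -
    have "((\<lambda>s. 0) has_real_derivative Vy x y) (at y)"
      by (rule has_field_derivative_transform_within_open[OF V, of "{T<..}"]) (use that V0 in auto)
    then show ?thesis using DERIV_unique DERIV_const by blast
  qed
  have Ueq: "U x y = U a y" if "y > T" for x y
    by (rule DERIV_isconst_all[of "\<lambda>s. U s y"]) (use U[of y] Vy0[OF that] in auto)
  have Ux0: "U x T - U a T = 0" for x
  proof (rule lim[OF continuous_on_diff[OF cy[OF contU, of x] cy[OF contU, of a]]])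
    show "U x y - U a y = 0" if "y > T" for y using Ueq[OF that, of x] by simp
  qed
  have "U x T \<le> 0" for x using Ux0[of x] aT(1) by simp
  moreover have "V x T = 0" for x by (rule lim[OF cy[OF contV] V0])
  moreover have "Vy x T = 0" for x by (rule lim[OF cy[OF contVy] Vy0])
  ultimately show ?thesis using that[of T] aT(1) by simp
qed

section \<open>Uniform decay of V and the sign of U\<close>

text \<open>Decay on each vertical line becomes uniform: a finite net of one period controls
  finitely many lines, and the Lipschitz bound in x controls the points between them.\<close>

lemma uniform_decay:
  assumes L: "L > 0" and per: "x_periodic L V"
    and V: "\<And>x y. ((\<lambda>s. V s y) has_real_derivative Vx x y) (at x)"
    and B: "\<And>x y. \<bar>Vx x y\<bar> \<le> B" and dec: "decays_in_y V" and e: "e > 0"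
  obtains R where "\<And>x y. \<bar>y\<bar> \<ge> R \<Longrightarrow> \<bar>V x y\<bar> < e"
proof -
  have B0: "B \<ge> 0" using B[of 0 0] by linarith
  \<comment> \<open>With this mesh the Lipschitz error stays below \<open>e / 2\<close>; the summand
    1 covers \<open>B = 0\<close>.\<close>
  define r where "r = e / (2 * (B + 1))"
  have r: "r > 0" "B * r < e / 2"
  proof -
    show "r > 0" using B0 e by (simp add: r_def)
    have "B * r = (e / 2) * (B / (B + 1))" using B0 by (simp add: r_def field_simps)
    also have "\<dots> < (e / 2) * 1" using B0 e by (intro mult_strict_left_mono) (auto simp: field_simps)
    finally show "B * r < e / 2" by simp
  qed
  obtain T where T: "finite T" "{0..L} \<subseteq> (\<Union>t\<in>T. ball t r)"
    using compactE_image[OF compact_Icc, of "{0..L}" "\<lambda>t. ball t r" "0" "L"] r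
    by (metis (no_types, lifting) UN_iff centre_in_ball open_ball subsetI)
  have "\<exists>R. \<forall>y. \<bar>y\<bar> \<ge> R \<longrightarrow> \<bar>V t y\<bar> < e / 2" for t
  proof -
    have "((\<lambda>y. V t y) \<longlongrightarrow> 0) at_top" "((\<lambda>y. V t y) \<longlongrightarrow> 0) at_bot"
      using dec by (auto simp: decays_in_y_def)
    then have "\<forall>\<^sub>F y in at_top. dist (V t y) 0 < e / 2" "\<forall>\<^sub>F y in at_bot. dist (V t y) 0 < e / 2"
      using e by (intro tendstoD; simp)+
    then obtain M N where MN: "\<And>y. y \<ge> M \<Longrightarrow> \<bar>V t y\<bar> < e / 2" "\<And>y. y \<le> N \<Longrightarrow> \<bar>V t y\<bar> < e / 2"
      by (auto simp: eventually_at_top_linorder eventually_at_bot_linorder)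
    have "\<bar>V t y\<bar> < e / 2" if "max M (- N) \<le> \<bar>y\<bar>" for y
      using MN(1)[of y] MN(2)[of y] that by (cases "y \<ge> 0") auto
    then show ?thesis by blast
  qed
  then obtain R where R: "\<And>t y. \<bar>y\<bar> \<ge> R t \<Longrightarrow> \<bar>V t y\<bar> < e / 2" by metis
  show ?thesis
  proof
    fix x y assume y: "\<bar>y\<bar> \<ge> Max (insert 0 (R ` T))"
    obtain n :: int where n: "0 \<le> x + of_int n * L" "x + of_int n * L \<le> L"
      using x_periodic_shift[OF L] .
    then obtain t where t: "t \<in> T" "x + of_int n * L \<in> ball t r" using T by fastforce
    have "R t \<le> \<bar>y\<bar>" using y T t by auto
    then have "\<bar>V t y\<bar> < e / 2" by (rule R)
    moreover have "norm (V (x + of_int n * L) y - V t y) \<le> B * norm (x + of_int n * L - t)"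
      by (rule field_differentiable_bound[of UNIV "\<lambda>s. V s y" "\<lambda>s. Vx s y"]) (use V B in auto)
    moreover have "B * norm (x + of_int n * L - t) \<le> B * r"
      using t B0 by (intro mult_left_mono) (auto simp: dist_real_def)
    ultimately have "\<bar>V (x + of_int n * L) y\<bar> < e" using r by simp
    then show "\<bar>V x y\<bar> < e" using x_periodic_int[OF per] by simp
  qed
qed

text \<open>Otherwise the maximum of V over the set where U is nonnegative would be attained at an
  interior point of that set, where V has a positive Laplacian.\<close>
lemma sign_of_velocity:
  assumes L: "L > 0" and perU: "x_periodic L U" and perV: "x_periodic L V"
    and contU: "continuous_on UNIV (\<lambda>(x, y). U x y)"
    and contV: "continuous_on UNIV (\<lambda>(x, y). V x y)"
    and V: "pure_partials V Vx Vy Vxx Vyy"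
    and eq: "\<And>x y. U x y * (Vxx x y + Vyy x y) = V x y * q x y"
    and q: "\<And>x y. q x y > 0"
    and dec: "\<And>e. e > 0 \<Longrightarrow> \<exists>R. \<forall>x y. \<bar>y\<bar> \<ge> R \<longrightarrow> \<bar>V x y\<bar> < e"
    and p: "V px py > 0"
  shows "U px py < 0"
proof (rule ccontr)
  assume "\<not> U px py < 0"
  \<comment> \<open>The second condition confines the set to bounded y, by the decay of
    \<open>V\<close>.\<close>
  let ?E = "{(x, y). 0 \<le> U x y} \<inter> {(x, y). V px py \<le> V x y}"
  obtain R where R: "\<And>x y. \<bar>y\<bar> \<ge> R \<Longrightarrow> \<bar>V x y\<bar> < V px py" using dec[OF p] by blast
  obtain a b where ab: "(a, b) \<in> ?E" "\<And>x y. (x, y) \<in> ?E \<Longrightarrow> V x y \<le> V a b"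
  proof (rule periodic_attains_sup[OF L, of ?E px py R V])
    show "closed ?E"
      by (intro closed_Int closed_le_fun contU contV) (auto simp: case_prod_unfold)
    show "(x, y) \<in> ?E \<Longrightarrow> (x + of_int n * L, y) \<in> ?E" for x y n
      using x_periodic_int[OF perU] x_periodic_int[OF perV] by auto
    show "(x, y) \<in> ?E \<Longrightarrow> \<bar>y\<bar> \<le> R" for x y using R[of y x] by force
    show "continuous_on ?E (\<lambda>(x, y). V x y)" using contV by (rule continuous_on_subset) auto
  qed (use perV \<open>\<not> U px py < 0\<close> in auto)
  have Vab: "V a b > 0" using ab(1) p by auto
  then have "V a b * q a b > 0" using q by simp
  then have U: "U a b * (Vxx a b + Vyy a b) > 0" using eq by simp
  \<comment> \<open>The equation rules out \<open>U = 0\<close> at the maximum, which therefore lies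
    in the open set where \<open>U\<close> is positive. Points of that set outside \<open>?E\<close>
    have smaller \<open>V\<close>, so the maximum is a genuine local one.\<close>
  then have Uab: "U a b > 0" using ab(1) by (cases "U a b = 0") auto
  have "Vxx a b + Vyy a b \<le> 0"
  proof (rule laplacian_nonpos_at_local_max[OF V])
    show "open {(x, y). 0 < U x y}"
      using open_Collect_less[of "\<lambda>_. 0" "\<lambda>(x, y). U x y"] contU by (simp add: case_prod_unfold)
    show "(a, b) \<in> {(x, y). 0 < U x y}" using Uab by simp
    show "V x y \<le> V a b" if "(x, y) \<in> {(x, y). 0 < U x y}" for x y
      using that ab by (cases "V px py \<le> V x y") auto
  qed
  with U Uab show False by (simp add: zero_less_mult_iff)
qed

section \<open>Maximum principle for the quotient of V and U\<close>

text \<open>The function h = V / (- U) tends to 0 at the boundary and satisfies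
  div (U^2 grad h) = - \<beta> h U, so it has no positive maximum. The exponential
  perturbation makes the maximum principle strict.\<close>
lemma velocity_nonpos_in_strip:
  assumes L: "L > 0" and perU: "x_periodic L U" and perV: "x_periodic L V"
    and contU: "continuous_on UNIV (\<lambda>(x, y). U x y)"
    and contUy: "continuous_on UNIV (\<lambda>(x, y). Uy x y)"
    and contV: "continuous_on UNIV (\<lambda>(x, y). V x y)"
    and perUy: "x_periodic L Uy"
    and U: "pure_partials U Ux Uy Uxx Uyy" and V: "pure_partials V Vx Vy Vxx Vyy"
    and eq: "\<And>x y. U x y * (Vxx x y + Vyy x y) = V x y * (Uxx x y + Uyy x y - \<beta>)"
    and \<beta>: "\<beta> \<ge> 0" and neg: "\<And>x y. a < y \<Longrightarrow> y < b \<Longrightarrow> U x y < 0"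
    and small: "\<And>e. e > 0 \<Longrightarrow> \<exists>d > 0. \<forall>x y. a < y \<and> y < b \<and> (y < a + d \<or> b - d < y) \<longrightarrow> V x y < e * (- U x y)"
    and p: "a < py" "py < b"
  shows "V px py \<le> 0"
proof (rule ccontr)
  assume "\<not> V px py \<le> 0"
  define h where "h = (\<lambda>x y. V x y / (- U x y))"
  define m0 where "m0 = h px py"
  have m0: "m0 > 0" using \<open>\<not> V px py \<le> 0\<close> neg[OF p, of px] by (simp add: m0_def h_def divide_pos_neg)
  obtain d where d: "d > 0" and dsmall: "\<And>x y. a < y \<Longrightarrow> y < b \<Longrightarrow> y < a + d \<or> b - d < y \<Longrightarrow> V x y < m0 / 2 * (- U x y)"
    using small[of "m0 / 2"] m0 by auto
  have hsmall: "h x y < m0 / 2" if "a < y" "y < b" "y < a + d \<or> b - d < y" for x y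
    using dsmall[OF that, of x] neg[OF that(1,2), of x] by (simp add: h_def field_simps)
  have pd: "a + d \<le> py" "py \<le> b - d"
    using hsmall[OF p, of px] m0 unfolding m0_def by linarith+
  \<comment> \<open>Halving \<open>d\<close> keeps the closed strip away from the lines where
    \<open>U\<close> may vanish, while \<open>h\<close> is still below \<open>m0 / 2\<close> on its
    boundary lines.\<close>
  define a' b' where "a' = a + d / 2" and "b' = b - d / 2"
  have a'b': "a < a'" "a' < py" "py < b'" "b' < b" "a' < a + d" "b - d < b'"
    using d pd by (auto simp: a'_def b'_def)
  let ?K = "UNIV \<times> {a'..b'} :: (real \<times> real) set"
  have K: "closed ?K" "(px, py) \<in> ?K" "\<And>(x::real) y n. (x, y) \<in> ?K \<Longrightarrow> (x + of_int n * L, y) \<in> ?K"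
      "\<And>(x::real) y. (x, y) \<in> ?K \<Longrightarrow> \<bar>y\<bar> \<le> max \<bar>a'\<bar> \<bar>b'\<bar>"
    using a'b' by (auto intro: closed_Times)
  have cK: "continuous_on ?K (\<lambda>(x, y). f x y)" if "continuous_on UNIV (\<lambda>(x, y). f x y)"
    for f :: "real \<Rightarrow> real \<Rightarrow> real" using that by (rule continuous_on_subset) auto
  obtain s t where st: "(s, t) \<in> ?K" "\<And>x y. (x, y) \<in> ?K \<Longrightarrow> U x y \<le> U s t"
    by (rule periodic_attains_sup[OF L K(1,2) _ _ cK[OF contU] perU, of "max \<bar>a'\<bar> \<bar>b'\<bar>"]) (use K(3,4) in auto)
  have perUy': "x_periodic L (\<lambda>x y. \<bar>Uy x y\<bar>)" using perUy by (simp add: x_periodic_def)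
  have contUy': "continuous_on UNIV (\<lambda>(x, y). \<bar>Uy x y\<bar>)"
    using contUy by (auto simp: case_prod_unfold intro!: continuous_intros)
  obtain s' t' where st': "\<And>x y. (x, y) \<in> ?K \<Longrightarrow> \<bar>Uy x y\<bar> \<le> \<bar>Uy s' t'\<bar>"
    by (rule periodic_attains_sup[OF L K(1,2) _ _ cK[OF contUy'] perUy', of "max \<bar>a'\<bar> \<bar>b'\<bar>"]) (use K(3,4) in auto)
  define u0 where "u0 = - U s t"
  define B where "B = \<bar>Uy s' t'\<bar>"
  have u0: "u0 > 0" using neg st(1) a'b' by (auto simp: u0_def)
  \<comment> \<open>\<open>u0\<close> is the minimum of \<open>- U\<close> and \<open>B\<close> the
    maximum of the absolute value of \<open>Uy\<close> on the closed strip. This \<open>k\<close>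
    makes \<open>2 * Uy + k * U\<close> negative there, which fixes the sign of the contribution of
    the exponential.\<close>
  define k where "k = (2 * B + 1) / u0"
  have k: "k > 0" using u0 by (simp add: k_def B_def)
  have kU: "2 * Uy x y + k * U x y < 0" if "(x, y) \<in> ?K" for x y
  proof -
    have "k * U x y \<le> k * (- u0)" using st(2)[OF that] k by (intro mult_left_mono) (auto simp: u0_def)
    also have "\<dots> = - (2 * B + 1)" using u0 by (simp add: k_def)
    finally show ?thesis using st'[OF that] by (simp add: B_def)
  qed
  \<comment> \<open>The perturbation is at most \<open>m0 / 4\<close> on the closed strip. Hence
    \<open>h\<close> exceeds \<open>m0 / 2\<close> at a maximum of \<open>H\<close>, which therefore
    lies off the boundary lines.\<close>
  define e where "e = m0 / (4 * exp (k * b'))"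
  have e: "e > 0" using m0 by (simp add: e_def)
  have eb: "e * exp (k * y) \<le> m0 / 4" if "y \<le> b'" for y
  proof -
    have "e * exp (k * y) \<le> e * exp (k * b')" using that e k by simp
    then show ?thesis by (simp add: e_def)
  qed
  have Upos: "U x y < 0" if "(x, y) \<in> ?K" for x y using that neg a'b' by auto
  define H where "H = (\<lambda>x y. h x y + e * exp (k * y))"
  obtain c f where cf: "(c, f) \<in> ?K" "\<And>x y. (x, y) \<in> ?K \<Longrightarrow> H x y \<le> H c f"
  proof (rule periodic_attains_sup[OF L K(1,2), of "max \<bar>a'\<bar> \<bar>b'\<bar>" H])
    show "continuous_on ?K (\<lambda>(x, y). H x y)"
      using cK[OF contU] cK[OF contV] Upos unfolding H_def h_def case_prod_unfold
      by (intro continuous_intros) (auto simp: less_imp_neq)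
    show "x_periodic L H" using perU perV by (simp add: x_periodic_def H_def h_def)
  qed (use K(3,4) in auto)
  define m where "m = H c f"
  have mm0: "m > m0" using cf(2)[OF K(2)] e unfolding m_def H_def m0_def
    by (smt (verit) exp_gt_zero mult_pos_pos)
  have hc: "h c f > m0 / 2" using mm0 eb[of f] cf(1) m0 unfolding m_def H_def by auto
  have f: "a' < f" "f < b'"
    using hc hsmall[of a' c] hsmall[of b' c] a'b' cf(1) by (force simp: le_less)+
  \<comment> \<open>On the strip \<open>Z = (m - H) * U \<le> 0\<close>, with equality at the
    maximum of \<open>H\<close>. So \<open>Z\<close> has a local maximum there, and its Laplacian is
    computed without differentiating a quotient.\<close>
  define Z where "Z = (\<lambda>x y. V x y + (m - e * exp (k * y)) * U x y)"
  define Zyy where "Zyy = (\<lambda>x y. Vyy x y + (m - e * exp (k * y)) * Uyy x y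
      - 2 * (e * k * exp (k * y)) * Uy x y - e * k * k * exp (k * y) * U x y)"
  have Zp: "pure_partials Z (\<lambda>x y. Vx x y + (m - e * exp (k * y)) * Ux x y)
     (\<lambda>x y. Vy x y + (m - e * exp (k * y)) * Uy x y - e * k * exp (k * y) * U x y)
     (\<lambda>x y. Vxx x y + (m - e * exp (k * y)) * Uxx x y) Zyy"
    unfolding pure_partials_def Z_def Zyy_def
    by (intro allI conjI; (rule derivative_eq_intros pure_partialsD[OF U] pure_partialsD[OF V] refl
        | simp add: algebra_simps)+)
  have Vh: "V x y = - h x y * U x y" if "(x, y) \<in> ?K" for x y
    using Upos[OF that] by (simp add: h_def)
  have Zc: "Z c f = 0" using Vh[OF cf(1)] by (simp add: Z_def m_def H_def algebra_simps)
  have "Vxx c f + (m - e * exp (k * f)) * Uxx c f + Zyy c f \<le> 0"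
  proof (rule laplacian_nonpos_at_local_max[OF Zp])
    show "open (UNIV \<times> {a'<..<b'} :: (real \<times> real) set)" by (intro open_Times) auto
    show "(c, f) \<in> UNIV \<times> {a'<..<b'}" using f by auto
    fix x y :: real assume "(x, y) \<in> UNIV \<times> {a'<..<b'}"
    then have xy: "(x, y) \<in> ?K" by auto
    have "Z x y = (m - H x y) * U x y" using Vh[OF xy] by (simp add: Z_def H_def algebra_simps)
    also have "\<dots> \<le> 0" using cf(2)[OF xy] Upos[OF xy] by (simp add: m_def mult_nonneg_nonpos)
    finally show "Z x y \<le> Z c f" using Zc by simp
  qed
  moreover have mh: "m - e * exp (k * f) = h c f" by (simp add: m_def H_def)
  moreover have "Vxx c f + Vyy c f = - h c f * (Uxx c f + Uyy c f - \<beta>)"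
  proof -
    have "U c f * (Vxx c f + Vyy c f) = U c f * (- h c f * (Uxx c f + Uyy c f - \<beta>))"
      using eq[of c f] Vh[OF cf(1)] by (simp add: algebra_simps)
    then show ?thesis using Upos[OF cf(1)] by (metis less_irrefl mult_cancel_left)
  qed
  \<comment> \<open>The terms with the Laplacian of \<open>U\<close> cancel between the equation and
    the Laplacian of \<open>Z\<close>.\<close>
  ultimately have "h c f * \<beta> - e * k * exp (k * f) * (2 * Uy c f + k * U c f) \<le> 0"
    unfolding Zyy_def by (simp add: algebra_simps)
  moreover have "h c f * \<beta> \<ge> 0" using hc m0 \<beta> by simp
  moreover have "e * k * exp (k * f) * (2 * Uy c f + k * U c f) < 0"
    using e k kU[OF cf(1)] by (intro mult_pos_neg) auto
  ultimately show False by linarith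
qed

section \<open>Boundary behavior and vanishing of V\<close>

lemma x_periodic_dy:
  assumes "x_periodic L f"
    and "\<And>x y. ((\<lambda>s. f x s) has_real_derivative fy x y) (at y)"
  shows "x_periodic L fy"
  unfolding x_periodic_def
proof (intro allI)
  fix x y
  have "(\<lambda>s. f (x + L) s) = (\<lambda>s. f x s)" using assms(1) by (simp add: x_periodic_def)
  then show "fy (x + L) y = fy x y" using assms(2)[of "x + L" y] assms(2)[of x y] DERIV_unique by metis
qed

text \<open>Uniform continuity of \<open>Vy\<close> over one period makes \<open>Vy\<close> small
  near the line, and the mean value theorem then shows that \<open>V\<close> is of smaller order
  than the distance to the line, uniformly in x.\<close>

lemma small_near_line:
  assumes L: "L > 0" and perV: "x_periodic L V"
    and V: "\<And>x y. ((\<lambda>s. V x s) has_real_derivative Vy x y) (at y)"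
    and contVy: "continuous_on UNIV (\<lambda>(x, y). Vy x y)"
    and V0: "\<And>x. V x t = 0" and Vy0: "\<And>x. Vy x t = 0" and e: "e > 0"
  obtains d where "d > 0" "\<And>x y. \<bar>y - t\<bar> < d \<Longrightarrow> \<bar>V x y\<bar> \<le> e * \<bar>y - t\<bar>"
proof -
  let ?K = "cbox (0, t - 1) (L, t + 1)"
  have "uniformly_continuous_on ?K (\<lambda>(x, y). Vy x y)"
    using contVy by (intro compact_uniformly_continuous) (auto intro: continuous_on_subset)
  then obtain d where d: "d > 0"
    "\<And>p q. p \<in> ?K \<Longrightarrow> q \<in> ?K \<Longrightarrow> dist q p < d \<Longrightarrow> dist (case q of (x, y) \<Rightarrow> Vy x y) (case p of (x, y) \<Rightarrow> Vy x y) < e"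
    using e unfolding uniformly_continuous_on_def by metis
  show ?thesis
  proof
    show "min d 1 > 0" using d by simp
    fix x y assume y: "\<bar>y - t\<bar> < min d 1"
    obtain n :: int where n: "0 \<le> x + of_int n * L" "x + of_int n * L \<le> L"
      using x_periodic_shift[OF L] .
    let ?x = "x + of_int n * L"
    have bd: "\<bar>Vy ?x z\<bar> \<le> e" if "z \<in> ball t (min d 1)" for z
    proof -
      have "\<bar>z - t\<bar> < d" "t - 1 \<le> z" "z \<le> t + 1" using that by (auto simp: dist_real_def)
      then show ?thesis
        using d(2)[of "(?x, t)" "(?x, z)"] n Vy0[of ?x] by (simp add: dist_Pair_Pair dist_real_def)
    qed
    have "norm (V ?x y - V ?x t) \<le> e * norm (y - t)"
      by (rule field_differentiable_bound[of "ball t (min d 1)" "\<lambda>s. V ?x s" "\<lambda>s. Vy ?x s"])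
        (use V bd y d in \<open>auto simp: dist_real_def abs_minus_commute intro: has_field_derivative_at_within\<close>)
    then show "\<bar>V x y\<bar> \<le> e * \<bar>y - t\<bar>" using V0 x_periodic_int[OF perV] by simp
  qed
qed

text \<open>The normalized form of the result, with U = u - c and V = v up to a common sign. A
  nonzero value of V is enclosed between two lines, and the maximum principle for the quotient is
  applied to V and to -V.\<close>

lemma velocity_vanishes:
  assumes L: "L > 0" and perU: "x_periodic L U" and perV: "x_periodic L V"
    and contU: "continuous_on UNIV (\<lambda>(x, y). U x y)"
    and contUy: "continuous_on UNIV (\<lambda>(x, y). Uy x y)"
    and contV: "continuous_on UNIV (\<lambda>(x, y). V x y)"
    and contVy: "continuous_on UNIV (\<lambda>(x, y). Vy x y)"
    and U: "pure_partials U Ux Uy Uxx Uyy" and V: "pure_partials V Vx Vy Vxx Vyy"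
    and div: "\<And>x y. Ux x y = - Vy x y"
    and eq: "\<And>x y. U x y * (Vxx x y + Vyy x y) = V x y * (Uxx x y + Uyy x y - \<beta>)"
    and \<beta>: "\<beta> \<ge> 0" and \<delta>: "\<delta> > 0" and lap: "\<And>x y. Uxx x y + Uyy x y \<ge> \<beta> + \<delta>"
    and Bx: "\<And>x y. \<bar>Vx x y\<bar> \<le> B" and By: "\<And>x y. \<bar>Vy x y\<bar> \<le> C" and dec: "decays_in_y V"
  shows "V px py = 0"
proof (rule ccontr)
  assume Vp: "V px py \<noteq> 0"
  have udec: "\<exists>R. \<forall>x y. \<bar>y\<bar> \<ge> R \<longrightarrow> \<bar>V x y\<bar> < e" if "e > 0" for e
    using uniform_decay[OF L perV pure_partialsD(1)[OF V] Bx dec that] by metis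
  \<comment> \<open>The equation is linear in \<open>V\<close>, so every one-sided statement derived
    from it also applies to \<open>- V\<close>.\<close>
  define W where "W = (\<lambda>x y. - V x y)"
  have W: "pure_partials W (\<lambda>x y. - Vx x y) (\<lambda>x y. - Vy x y) (\<lambda>x y. - Vxx x y) (\<lambda>x y. - Vyy x y)"
    using pure_partials_scale[OF V, of "- 1" 0] by (simp add: W_def)
  have perW: "x_periodic L W" using perV by (simp add: W_def x_periodic_def)
  have contW: "continuous_on UNIV (\<lambda>(x, y). W x y)"
    using contV unfolding W_def case_prod_unfold by (intro continuous_intros)
  have eqW: "U x y * (- Vxx x y + - Vyy x y) = W x y * (Uxx x y + Uyy x y - \<beta>)" for x y
    using eq[of x y] by (simp add: W_def algebra_simps)
  have q: "Uxx x y + Uyy x y - \<beta> > 0" for x y using lap[of x y] \<delta> by linarith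
  have neg: "U x y < 0" if "V x y \<noteq> 0" for x y
  proof (cases "V x y > 0")
    case True
    then show ?thesis using sign_of_velocity[OF L perU perV contU contV V eq q udec] by blast
  next
    case False
    then have "W x y > 0" using that by (simp add: W_def)
    moreover have "\<exists>R. \<forall>x y. \<bar>y\<bar> \<ge> R \<longrightarrow> \<bar>W x y\<bar> < e" if "e > 0" for e
      using udec[OF that] by (simp add: W_def)
    ultimately show ?thesis using sign_of_velocity[OF L perU perW contU contW W eqW q] by blast
  qed
  have lap': "Uxx x y + Uyy x y \<ge> \<delta>" and Ux: "\<bar>Ux x y\<bar> \<le> C" for x y
    using lap[of x y] \<beta> By[of x y] div[of x y] by auto
  have refl_cont: "continuous_on UNIV (\<lambda>(x, y). f x (- y))"
    if "continuous_on UNIV (\<lambda>(x, y). f x y)" for f :: "real \<Rightarrow> real \<Rightarrow> real"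
  proof -
    have "continuous_on UNIV (\<lambda>p::real \<times> real. (fst p, - snd p))" by (intro continuous_intros)
    from continuous_on_compose2[OF that this] show ?thesis by (simp add: case_prod_unfold)
  qed
  note rU = pure_partials_reflect[OF U] and rW = pure_partials_reflect[OF W]
  have rper: "x_periodic L (\<lambda>x y. U x (- y))" using perU by (simp add: x_periodic_def)
  obtain R1 where R1: "\<And>x y. y \<ge> R1 \<Longrightarrow> U x y > 0"
    using subharmonic_pos_at_top[OF L perU contU U lap' \<delta> Ux] by metis
  obtain R2 where R2: "\<And>x y. y \<ge> R2 \<Longrightarrow> U x (- y) > 0"
    using subharmonic_pos_at_top[OF L rper refl_cont[OF contU] rU lap' \<delta> Ux] by metis
  have Up: "U px py \<le> 0" using neg[OF Vp] by simp
  obtain T where T: "py \<le> T" "\<And>x. U x T \<le> 0" "\<And>x. V x T = 0" "\<And>x. Vy x T = 0"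
    using vanishing_top_line[OF L perU contU contV contVy
        pure_partialsD(1)[OF U, unfolded div] pure_partialsD(2)[OF V] neg R1 Up] by blast
  \<comment> \<open>Reflection in y preserves incompressibility only when the sign of
    \<open>V\<close> is changed too; the lower line therefore comes from \<open>W\<close>.\<close>
  have rV: "((\<lambda>s. W x (- s)) has_real_derivative Vy x (- y)) (at y)" for x y
    using pure_partialsD(2)[OF rW, of x y] by simp
  have rneg: "U x (- y) < 0" if "W x (- y) \<noteq> 0" for x y
    using neg that by (simp add: W_def)
  obtain S where S: "- py \<le> S" "\<And>x. U x (- S) \<le> 0" "\<And>x. W x (- S) = 0" "\<And>x. Vy x (- S) = 0"
  proof (rule vanishing_top_line[where L=L and U="\<lambda>x y. U x (- y)" and V="\<lambda>x y. W x (- y)"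
        and Vy="\<lambda>x y. Vy x (- y)" and R=R2 and px=px and py="- py"])
    show "((\<lambda>s. U s (- y)) has_real_derivative - Vy x (- y)) (at x)" for x y
      using pure_partialsD(1)[OF rU] by (simp add: div)
  qed (use L rper refl_cont contU contW contVy rV rneg R2 Up in auto)
  define b where "b = - S"
  have b: "b \<le> py" "\<And>x. U x b \<le> 0" "\<And>x. V x b = 0" "\<And>x. Vy x b = 0"
    using S by (auto simp: b_def W_def)
  \<comment> \<open>Strict, because \<open>V\<close> vanishes on both lines but not at
    \<open>(px, py)\<close>.\<close>
  have pb: "b < py" "py < T" using T b Vp by (auto simp: less_le)
  \<comment> \<open>Comparison with a parabola that vanishes on both lines and has Laplacian
    \<open>\<delta> / 2\<close>: \<open>- U\<close> grows at least linearly with the distance from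
    the boundary.\<close>
  have Uneg: "U x y < - (\<delta> / 4 * ((y - b) * (T - y)))" if y: "b < y" "y < T" for x y
  proof -
    define Z where "Z = (\<lambda>x y. U x y - \<delta> / 4 * ((y - b) * (y - T)))"
    have "Z x y < 0"
    proof (rule strip_max_principle[OF L, of Z Ux "\<lambda>x y. Uy x y - \<delta> / 4 * (2 * y - b - T)"
          Uxx "\<lambda>x y. Uyy x y - \<delta> / 2" b T])
      show "x_periodic L Z" using perU by (simp add: x_periodic_def Z_def)
      show "continuous_on UNIV (\<lambda>(x, y). Z x y)"
        using contU unfolding Z_def case_prod_unfold by (intro continuous_intros)
      show "pure_partials Z Ux (\<lambda>x y. Uy x y - \<delta> / 4 * (2 * y - b - T)) Uxx (\<lambda>x y. Uyy x y - \<delta> / 2)"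
        unfolding pure_partials_def Z_def
        by (intro allI conjI; (rule derivative_eq_intros pure_partialsD[OF U] refl | simp add: algebra_simps)+)
      show "Uxx x y + (Uyy x y - \<delta> / 2) > 0" for x y using lap'[of x y] \<delta> by linarith
    qed (use T b y in \<open>auto simp: Z_def\<close>)
    then show ?thesis by (simp add: Z_def algebra_simps)
  qed
  have small: "\<exists>d > 0. \<forall>x y. b < y \<and> y < T \<and> (y < b + d \<or> T - d < y) \<longrightarrow> \<bar>V x y\<bar> < e * (- U x y)"
    if e: "e > 0" for e
  proof -
    \<comment> \<open>Within \<open>(T - b) / 2\<close> of one line the other line is at least that
      far away, so \<open>- U\<close> is at least \<open>\<delta> / 4 * ((T - b) / 2)\<close> times
      the distance to the nearer one. \<open>\<eta>\<close> is \<open>e\<close> times this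
      slope.\<close>
    define \<eta> where "\<eta> = e * (\<delta> / 4 * ((T - b) / 2))"
    have \<eta>: "\<eta> > 0" using e \<delta> pb by (simp add: \<eta>_def)
    obtain d1 where d1: "d1 > 0" "\<And>x y. \<bar>y - T\<bar> < d1 \<Longrightarrow> \<bar>V x y\<bar> \<le> \<eta> * \<bar>y - T\<bar>"
      using small_near_line[OF L perV pure_partialsD(2)[OF V] contVy T(3,4) \<eta>] by metis
    obtain d2 where d2: "d2 > 0" "\<And>x y. \<bar>y - b\<bar> < d2 \<Longrightarrow> \<bar>V x y\<bar> \<le> \<eta> * \<bar>y - b\<bar>"
      using small_near_line[OF L perV pure_partialsD(2)[OF V] contVy b(3,4) \<eta>] by metis
    obtain d where d: "d > 0" "d \<le> d1" "d \<le> d2" "d \<le> (T - b) / 2"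
    proof -
      have "(T - b) / 2 > 0" using pb by simp
      then show ?thesis using that[of "min d1 (min d2 ((T - b) / 2))"] d1(1) d2(1)
        by (meson min.cobounded1 min.cobounded2 min_less_iff_conj order_trans)
    qed
    have "\<bar>V x y\<bar> < e * (- U x y)" if y: "b < y" "y < T" and yd: "y < b + d \<or> T - d < y" for x y
    proof -
      have "e * (\<delta> / 4 * ((y - b) * (T - y))) < e * (- U x y)"
        using Uneg[OF y, of x] e by (intro mult_strict_left_mono) auto
      moreover have "\<bar>V x y\<bar> \<le> e * (\<delta> / 4 * ((y - b) * (T - y)))"
        using yd
      proof
        assume yd: "y < b + d"
        then have "\<bar>V x y\<bar> \<le> \<eta> * (y - b)" using d2(2)[of y x] d y by auto
        also have "\<dots> = e * (\<delta> / 4 * ((y - b) * ((T - b) / 2)))" by (simp add: \<eta>_def)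
        also have "\<dots> \<le> e * (\<delta> / 4 * ((y - b) * (T - y)))"
          using e \<delta> y yd d by (intro mult_left_mono) auto
        finally show ?thesis .
      next
        assume yd: "T - d < y"
        then have "\<bar>V x y\<bar> \<le> \<eta> * (T - y)" using d1(2)[of y x] d y by auto
        also have "\<dots> = e * (\<delta> / 4 * (((T - b) / 2) * (T - y)))" by (simp add: \<eta>_def)
        also have "\<dots> \<le> e * (\<delta> / 4 * ((y - b) * (T - y)))"
          using e \<delta> y yd d by (intro mult_left_mono mult_right_mono) auto
        finally show ?thesis .
      qed
      ultimately show ?thesis by linarith
    qed
    then show ?thesis using d(1) by blast
  qed
  have Uneg0: "U x y < 0" if y: "b < y" "y < T" for x y
  proof -
    have "\<delta> / 4 * ((y - b) * (T - y)) > 0" using y \<delta> by simp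
    then show ?thesis using Uneg[OF y, of x] by linarith
  qed
  note perUy = x_periodic_dy[OF perU pure_partialsD(2)[OF U]]
  have "V px py \<le> 0"
  proof (rule velocity_nonpos_in_strip[OF L perU perV contU contUy contV perUy U V eq \<beta> Uneg0 _ pb])
    show "\<exists>d>0. \<forall>x y. b < y \<and> y < T \<and> (y < b + d \<or> T - d < y) \<longrightarrow> V x y < e * - U x y" if "e > 0" for e
      using small[OF that] by (meson abs_ge_self le_less_trans)
  qed
  moreover have "W px py \<le> 0"
  proof (rule velocity_nonpos_in_strip[OF L perU perW contU contUy contW perUy U W eqW \<beta> Uneg0 _ pb])
    show "\<exists>d>0. \<forall>x y. b < y \<and> y < T \<and> (y < b + d \<or> T - d < y) \<longrightarrow> W x y < e * - U x y" if "e > 0" for e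
      using small[OF that] unfolding W_def by (meson abs_ge_minus_self le_less_trans)
  qed
  ultimately show False using Vp by (simp add: W_def)
qed

section \<open>Elimination of the pressure\<close>

text \<open>Schwarz's theorem without assumptions on the pure second derivatives, because the pressure
  is only known to have first partial derivatives, which are then given by the equations.\<close>
lemma mixed_partials_eq:
  fixes P A B Ay Bx :: "real \<Rightarrow> real \<Rightarrow> real"
  assumes A: "\<And>x y. ((\<lambda>s. P s y) has_real_derivative A x y) (at x)"
    and B: "\<And>x y. ((\<lambda>s. P x s) has_real_derivative B x y) (at y)"
    and Ay: "\<And>x y. ((\<lambda>s. A x s) has_real_derivative Ay x y) (at y)"
    and Bx: "\<And>x y. ((\<lambda>s. B s y) has_real_derivative Bx x y) (at x)"
    and cA: "continuous_on UNIV (\<lambda>(x, y). Ay x y)"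
    and cB: "continuous_on UNIV (\<lambda>(x, y). Bx x y)"
  shows "Ay x y = Bx x y"
proof (rule ccontr)
  assume ne: "Ay x y \<noteq> Bx x y"
  define e where "e = \<bar>Ay x y - Bx x y\<bar> / 2"
  have e: "e > 0" using ne by (simp add: e_def)
  obtain d1 where d1: "d1 > 0" "\<And>s t. dist (s, t) (x, y) < d1 \<Longrightarrow> \<bar>Ay s t - Ay x y\<bar> < e"
    using cA e unfolding continuous_on_iff dist_real_def by (metis UNIV_I case_prodD case_prod_conv)
  obtain d2 where d2: "d2 > 0" "\<And>s t. dist (s, t) (x, y) < d2 \<Longrightarrow> \<bar>Bx s t - Bx x y\<bar> < e"
    using cB e unfolding continuous_on_iff dist_real_def by (metis UNIV_I case_prodD case_prod_conv)
  define h where "h = min d1 d2 / 2"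
  have h: "h > 0" "2 * h \<le> d1" "2 * h \<le> d2" using d1 d2 by (auto simp: h_def)
  have near: "dist (s, t) (x, y) < 2 * h" if "x < s" "s < x + h" "y < t" "t < y + h" for s t
  proof -
    have "dist (s, t) (x, y) \<le> \<bar>s - x\<bar> + \<bar>t - y\<bar>"
      by (simp add: dist_Pair_Pair dist_real_def sqrt_sum_squares_le_sum_abs)
    then show ?thesis using that by linarith
  qed
  \<comment> \<open>The second difference of \<open>P\<close> over a square of side \<open>h\<close>
    is evaluated in both orders, each time by two applications of the mean value theorem. This
    yields nearby points at which \<open>Ay\<close> and \<open>Bx\<close> agree, while
    \<open>e\<close>, half of the gap at \<open>(x, y)\<close>, keeps their values apart.\<close>
  have "\<exists>s>x. s < x + h \<and> (P (x + h) (y + h) - P (x + h) y) - (P x (y + h) - P x y)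
      = (x + h - x) * (A s (y + h) - A s y)"
    by (rule MVT2) (use h in \<open>auto intro!: DERIV_diff A\<close>)
  then obtain s where s: "x < s" "s < x + h"
    "(P (x + h) (y + h) - P (x + h) y) - (P x (y + h) - P x y) = (x + h - x) * (A s (y + h) - A s y)"
    by blast
  have "\<exists>t>y. t < y + h \<and> A s (y + h) - A s y = (y + h - y) * Ay s t"
    by (rule MVT2) (use h in \<open>auto intro!: Ay\<close>)
  then obtain t where t: "y < t" "t < y + h" "A s (y + h) - A s y = (y + h - y) * Ay s t"
    by blast
  have "\<exists>t'>y. t' < y + h \<and> (P (x + h) (y + h) - P x (y + h)) - (P (x + h) y - P x y)
      = (y + h - y) * (B (x + h) t' - B x t')"
    by (rule MVT2) (use h in \<open>auto intro!: DERIV_diff B\<close>)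
  then obtain t' where t': "y < t'" "t' < y + h"
    "(P (x + h) (y + h) - P x (y + h)) - (P (x + h) y - P x y) = (y + h - y) * (B (x + h) t' - B x t')"
    by blast
  have "\<exists>s'>x. s' < x + h \<and> B (x + h) t' - B x t' = (x + h - x) * Bx s' t'"
    by (rule MVT2) (use h in \<open>auto intro!: Bx\<close>)
  then obtain s' where s': "x < s'" "s' < x + h" "B (x + h) t' - B x t' = (x + h - x) * Bx s' t'"
    by blast
  have "h * (h * Ay s t) = h * (h * Bx s' t')"
    using s(3)[unfolded t(3)] t'(3)[unfolded s'(3)] by (simp only: add_diff_cancel_left')
  then have "Ay s t = Bx s' t'" using h by simp
  moreover have "\<bar>Ay s t - Ay x y\<bar> < e"
    by (rule d1(2)) (use near[of s t] s t h in linarith)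
  moreover have "\<bar>Bx s' t' - Bx x y\<bar> < e"
    by (rule d2(2)) (use near[of s' t'] s' t' h in linarith)
  ultimately show False unfolding e_def by (simp add: abs_if split: if_splits)
qed

text \<open>By continuity the set where the essential bound holds is closed, and a closed set of
  full measure is the whole plane.\<close>

lemma in_Linfty_bounded:
  assumes "continuous_on UNIV (\<lambda>(x, y). f x y)" "in_Linfty f"
  obtains C where "\<And>x y. \<bar>f x y\<bar> \<le> C"
proof -
  obtain C where C: "AE (x, y) in lebesgue. \<bar>f x y\<bar> \<le> C"
    using assms by (auto simp: in_Linfty_def)
  have "closed {(x, y). \<bar>f x y\<bar> \<le> C}"
    using assms(1) by (intro closed_le_fun) (auto simp: case_prod_unfold intro!: continuous_intros)
  then have "p \<in> {(x, y). \<bar>f x y\<bar> \<le> C}" for p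
    by (rule mem_closed_if_AE_lebesgue) (use C in \<open>auto simp: case_prod_unfold\<close>)
  then show ?thesis using that by auto
qed

lemma Ck_2D:
  assumes "Ck 2 f"
  shows "pure_partials f (dx f) (dy f) (dx (dx f)) (dy (dy f))"
    and "((\<lambda>s. dx f x s) has_real_derivative dy (dx f) x y) (at y)"
    and "((\<lambda>s. dy f s y) has_real_derivative dx (dy f) x y) (at x)"
    and "continuous_on UNIV (\<lambda>(x, y). f x y)"
    and "continuous_on UNIV (\<lambda>(x, y). dx f x y)" "continuous_on UNIV (\<lambda>(x, y). dy f x y)"
    and "continuous_on UNIV (\<lambda>(x, y). dx (dx f) x y)" "continuous_on UNIV (\<lambda>(x, y). dy (dx f) x y)"
    and "continuous_on UNIV (\<lambda>(x, y). dx (dy f) x y)" "continuous_on UNIV (\<lambda>(x, y). dy (dy f) x y)"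
proof -
  have d: "((\<lambda>s. g s y) has_real_derivative dx g x y) (at x)"
    "((\<lambda>s. g x s) has_real_derivative dy g x y) (at y)" if "partially_differentiable g" for g x y
    using that by (auto simp: partially_differentiable_def dx_def dy_def DERIV_deriv_iff_real_differentiable)
  have pd: "partially_differentiable f" "partially_differentiable (dx f)" "partially_differentiable (dy f)"
    using assms by (auto simp: numeral_2_eq_2)
  show "pure_partials f (dx f) (dy f) (dx (dx f)) (dy (dy f))"
    unfolding pure_partials_def using d pd by blast
  show "((\<lambda>s. dx f x s) has_real_derivative dy (dx f) x y) (at y)"
    "((\<lambda>s. dy f s y) has_real_derivative dx (dy f) x y) (at x)" using d pd by blast+
qed (use assms in \<open>auto simp: numeral_2_eq_2\<close>)

text \<open>At time 0 the time derivative is -c times the x-derivative, and cross-differentiation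
  removes the pressure. By incompressibility the vorticity v_x - u_y has x-derivative \<Delta>v and
  y-derivative -\<Delta>u, so the vorticity equation takes the stated form.\<close>

lemma traveling_wave_vorticity:
  assumes u: "Ck 2 u" and v: "Ck 2 v" and tw: "traveling_wave L \<beta> c u v"
  shows "dx u x y = - dy v x y"
    and "(u x y - c) * laplacian v x y = v x y * (laplacian u x y - \<beta>)"
proof -
  note du = pure_partialsD[OF Ck_2D(1)[OF u]] Ck_2D(2,3)[OF u]
  note dv = pure_partialsD[OF Ck_2D(1)[OF v]] Ck_2D(2,3)[OF v]
  note cu = Ck_2D(4-)[OF u, unfolded case_prod_unfold]
  note cv = Ck_2D(4-)[OF v, unfolded case_prod_unfold]
  obtain P where P: "beta_plane_solution L \<beta> (\<lambda>t x y. u (x - c * t) y) (\<lambda>t x y. v (x - c * t) y) P"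
    using tw by (auto simp: traveling_wave_def)
  have "((\<lambda>s. x - c * s) has_real_derivative - c) (at 0)" for x
    by (auto intro!: derivative_eq_intros)
  then have t: "deriv (\<lambda>s. u (x - c * s) y) 0 = dx u x y * - c"
    "deriv (\<lambda>s. v (x - c * s) y) 0 = dx v x y * - c" for x y
    by (intro DERIV_imp_deriv DERIV_chain2; simp add: du dv)+
  have pdP: "partially_differentiable (P 0)" using P by (simp add: beta_plane_solution_def)
  then have dP: "((\<lambda>s. P 0 s y) has_real_derivative dx (P 0) x y) (at x)"
    "((\<lambda>s. P 0 x s) has_real_derivative dy (P 0) x y) (at y)" for x y
    by (auto simp: partially_differentiable_def dx_def dy_def DERIV_deriv_iff_real_differentiable)
  have eqs: "dx u x y * - c + u x y * dx u x y + v x y * dy u x y - \<beta> * y * v x y = - dx (P 0) x y"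
    "dx v x y * - c + u x y * dx v x y + v x y * dy v x y + \<beta> * y * u x y = - dy (P 0) x y"
    and div: "dx u x y + dy v x y = 0" for x y
    using P[unfolded beta_plane_solution_def, THEN conjunct2, THEN conjunct2, THEN conjunct2, THEN spec[of _ 0], THEN spec[of _ x], THEN spec[of _ y]]
    by (simp_all add: t)
  have divu: "dx u x y = - dy v x y" for x y using div[of x y] by simp
  then show "dx u x y = - dy v x y" .
  \<comment> \<open>Differentiated incompressibility relates the mixed derivatives
    \<open>dx (dy v)\<close> and \<open>dy (dx u)\<close> to pure ones, so that Laplacians
    appear.\<close>
  have uxx: "dx (dx u) x y = - dx (dy v) x y" for x y
  proof (rule DERIV_unique[OF du(3)])
    show "((\<lambda>s. dx u s y) has_real_derivative - dx (dy v) x y) (at x)"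
      unfolding divu by (rule DERIV_minus[OF dv(6)])
  qed
  have uxy: "dy (dx u) x y = - dy (dy v) x y" for x y
  proof (rule DERIV_unique[OF du(5)])
    show "((\<lambda>s. dx u x s) has_real_derivative - dy (dy v) x y) (at y)"
      unfolding divu by (rule DERIV_minus[OF dv(4)])
  qed
  define A where "A = (\<lambda>x y. c * dx u x y - u x y * dx u x y - v x y * dy u x y + \<beta> * y * v x y)"
  define B where "B = (\<lambda>x y. c * dx v x y - u x y * dx v x y - v x y * dy v x y - \<beta> * y * u x y)"
  define Ay where "Ay = (\<lambda>x y. c * dy (dx u) x y - (dy u x y * dx u x y + u x y * dy (dx u) x y)
     - (dy v x y * dy u x y + v x y * dy (dy u) x y) + (\<beta> * v x y + \<beta> * y * dy v x y))"
  define Bx where "Bx = (\<lambda>x y. c * dx (dx v) x y - (dx u x y * dx v x y + u x y * dx (dx v) x y)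
     - (dx v x y * dy v x y + v x y * dx (dy v) x y) - \<beta> * y * dx u x y)"
  have PA: "dx (P 0) x y = A x y" "dy (P 0) x y = B x y" for x y
    using eqs[of x y] by (simp_all add: A_def B_def algebra_simps)
  have "Ay x y = Bx x y"
  proof (rule mixed_partials_eq[where P="P 0" and A=A and B=B and Ay=Ay and Bx=Bx])
    show "((\<lambda>s. P 0 s y) has_real_derivative A x y) (at x)"
      "((\<lambda>s. P 0 x s) has_real_derivative B x y) (at y)" for x y
      using dP[where x=x and y=y] by (simp_all add: PA)
    show "((\<lambda>s. A x s) has_real_derivative Ay x y) (at y)" for x y
      unfolding A_def Ay_def
      by ((rule derivative_eq_intros du dv refl | simp add: algebra_simps)+)
    show "((\<lambda>s. B s y) has_real_derivative Bx x y) (at x)" for x y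
      unfolding B_def Bx_def
      by ((rule derivative_eq_intros du dv refl | simp add: algebra_simps)+)
    show "continuous_on UNIV (\<lambda>(x, y). Ay x y)" "continuous_on UNIV (\<lambda>(x, y). Bx x y)"
      unfolding Ay_def Bx_def case_prod_unfold by (intro continuous_intros cu cv)+
  qed
  then show "(u x y - c) * laplacian v x y = v x y * (laplacian u x y - \<beta>)"
    unfolding Ay_def Bx_def laplacian_def uxx uxy divu by (simp add: algebra_simps)
qed

section \<open>Choice of sign and conclusion\<close>

text \<open>The range of a continuous function on the connected plane is an interval; as it misses a
  ball around 0, it lies on one side of it.\<close>

lemma bounded_away_one_sign:
  assumes "continuous_on UNIV (\<lambda>(x, y). f x y)" "0 \<notin> closure (Ran f)"
  obtains s \<delta> where "s = 1 \<or> s = - 1" "\<delta> > 0" "\<And>x y. s * f x y \<ge> \<delta>"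
proof -
  have "open (- closure (Ran f))" "0 \<in> - closure (Ran f)" using assms(2) by auto
  then obtain \<delta> where "\<delta> > 0" "ball 0 \<delta> \<subseteq> - closure (Ran f)" by (rule openE)
  then have \<delta>: "\<delta> > 0" "ball 0 \<delta> \<inter> Ran f = {}" using closure_subset by blast+
  have big: "\<bar>f x y\<bar> \<ge> \<delta>" for x y
    using \<delta>(2) by (force simp: Ran_def disjoint_iff dist_real_def not_less)
  have "connected (Ran f)"
    unfolding Ran_def by (rule connected_continuous_image[OF assms(1) connected_UNIV])
  then have conn: "\<And>a b. a \<in> Ran f \<Longrightarrow> b \<in> Ran f \<Longrightarrow> {a..b} \<subseteq> Ran f"
    using connected_contains_Icc by blast
  have R: "f x y \<in> Ran f" for x y unfolding Ran_def by (metis (mono_tags) case_prod_conv rangeI)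
  have "0 \<notin> Ran f" using closure_subset[of "Ran f"] assms(2) by blast
  show ?thesis
  proof (cases "f 0 0 > 0")
    case True
    have "1 * f x y \<ge> \<delta>" for x y
    proof -
      have "\<not> f x y \<le> 0"
        using conn[OF R[of x y] R[of 0 0]] \<open>0 \<notin> Ran f\<close> True by (meson atLeastAtMost_iff less_imp_le subsetD)
      then show ?thesis using big[of x y] by simp
    qed
    then show ?thesis using that[of 1] \<delta> by blast
  next
    case False
    have "- 1 * f x y \<ge> \<delta>" for x y
    proof -
      have "\<not> f x y \<ge> 0"
        using conn[OF R[of 0 0] R[of x y]] \<open>0 \<notin> Ran f\<close> False by (meson atLeastAtMost_iff linorder_not_less subsetD)
      then show ?thesis using big[of x y] by simp
    qed
    then show ?thesis using that[of "- 1"] \<delta> by blast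
  qed
qed

theorem theorem4p5:
  fixes L \<beta> c :: real and u v :: "real \<Rightarrow> real \<Rightarrow> real"
  assumes "L > 0" and "\<beta> \<ge> 0"
    and "x_periodic L u" and "x_periodic L v"
    and "Ck 2 u" and "Ck 2 v"
    and "traveling_wave L \<beta> c u v"
    and "decays_in_y v"
    and "in_Linfty (dx v)" and "in_Linfty (dy v)" and "in_Linfty (laplacian v)"
    and "decays_in_y (\<lambda>x y. v x y * dy u x y)"
    and "(inf_val (laplacian u) > 0 \<and> 0 < \<beta> \<and> ereal \<beta> < inf_val (laplacian u))
         \<or> (\<beta> = 0 \<and> 0 \<notin> closure (Ran (laplacian u)))"
  shows "shear_flow u v"
proof -
  note u = Ck_2D[OF \<open>Ck 2 u\<close>] and v = Ck_2D[OF \<open>Ck 2 v\<close>]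
  note vort = traveling_wave_vorticity[OF \<open>Ck 2 u\<close> \<open>Ck 2 v\<close> \<open>traveling_wave L \<beta> c u v\<close>]
  obtain B where B: "\<And>x y. \<bar>dx v x y\<bar> \<le> B" using in_Linfty_bounded[OF v(5) \<open>in_Linfty (dx v)\<close>] by metis
  obtain C where C: "\<And>x y. \<bar>dy v x y\<bar> \<le> C" using in_Linfty_bounded[OF v(6) \<open>in_Linfty (dy v)\<close>] by metis
  have contlap: "continuous_on UNIV (\<lambda>(x, y). laplacian u x y)"
    using u(7,10) unfolding laplacian_def case_prod_unfold by (intro continuous_intros)
  \<comment> \<open>Condition (i) gives \<open>s = 1\<close>, with \<open>\<delta>\<close> from a
    real number strictly between \<open>\<beta>\<close> and the infimum. Condition (ii) allows
    either sign.\<close>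
  obtain s \<delta> where s: "s = 1 \<or> s = - 1" "s = 1 \<or> \<beta> = 0" and \<delta>: "\<delta> > 0"
    and lap: "\<And>x y. s * laplacian u x y \<ge> \<beta> + \<delta>"
    using assms(13)
  proof
    assume "inf_val (laplacian u) > 0 \<and> 0 < \<beta> \<and> ereal \<beta> < inf_val (laplacian u)"
    then obtain r where r: "ereal \<beta> < ereal r" "ereal r < inf_val (laplacian u)"
      using ereal_dense2 by blast
    have "inf_val (laplacian u) \<le> ereal (laplacian u x y)" for x y
      using INF_lower[of "(x, y)" UNIV "\<lambda>(x, y). ereal (laplacian u x y)"]
      unfolding inf_val_def by simp
    then have "ereal r \<le> ereal (laplacian u x y)" for x y
      using r(2) by (meson less_imp_le order_trans)
    then show ?thesis using that[of 1 "r - \<beta>"] r(1) by simp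
  next
    assume b: "\<beta> = 0 \<and> 0 \<notin> closure (Ran (laplacian u))"
    obtain s \<delta> where "s = 1 \<or> s = - 1" "\<delta> > 0" "\<And>x y. s * laplacian u x y \<ge> \<delta>"
      using bounded_away_one_sign[OF contlap] b by blast
    then show ?thesis using that[of s \<delta>] b by simp
  qed
  \<comment> \<open>Moving frame with the common sign; \<open>- 0\<close> gives \<open>?V\<close>
    the shape of \<open>pure_partials_scale\<close>.\<close>
  let ?U = "\<lambda>x y. s * (u x y - c)" and ?V = "\<lambda>x y. s * (v x y - 0)"
  have ss: "s * s = 1" "\<bar>s\<bar> = 1" using s by auto
  have "?V x y = 0" for x y
  proof (rule velocity_vanishes[OF \<open>L > 0\<close>, of ?U ?V "\<lambda>x y. s * dy u x y" "\<lambda>x y. s * dy v x y"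
        _ _ _ _ _ _ \<beta> \<delta> B C])
    show "pure_partials ?U (\<lambda>x y. s * dx u x y) (\<lambda>x y. s * dy u x y) (\<lambda>x y. s * dx (dx u) x y) (\<lambda>x y. s * dy (dy u) x y)"
      by (rule pure_partials_scale[OF u(1)])
    show "pure_partials ?V (\<lambda>x y. s * dx v x y) (\<lambda>x y. s * dy v x y) (\<lambda>x y. s * dx (dx v) x y) (\<lambda>x y. s * dy (dy v) x y)"
      by (rule pure_partials_scale[OF v(1)])
    show "x_periodic L ?U" "x_periodic L ?V" using assms(3,4) by (auto simp: x_periodic_def)
    show "continuous_on UNIV (\<lambda>(x, y). ?U x y)" "continuous_on UNIV (\<lambda>(x, y). s * dy u x y)"
      "continuous_on UNIV (\<lambda>(x, y). ?V x y)" "continuous_on UNIV (\<lambda>(x, y). s * dy v x y)"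
      using u(4,6) v(4,6) unfolding case_prod_unfold by (auto intro!: continuous_intros)
    show "s * dx u x y = - (s * dy v x y)" for x y using vort(1) by simp
    show "s * (u x y - c) * (s * dx (dx v) x y + s * dy (dy v) x y)
        = s * (v x y - 0) * (s * dx (dx u) x y + s * dy (dy u) x y - \<beta>)" for x y
    proof -
      \<comment> \<open>The left side is unchanged since \<open>s * s = 1\<close>. On the right
        \<open>s * \<beta> = \<beta>\<close>, because \<open>s = 1\<close> or
        \<open>\<beta> = 0\<close>.\<close>
      have "(s * s) * ((u x y - c) * laplacian v x y) = s * v x y * (s * laplacian u x y - \<beta>)"
        using vort(2)[of x y] s by (auto simp: algebra_simps)
      then show ?thesis by (simp add: laplacian_def algebra_simps)
    qed
    show "s * dx (dx u) x y + s * dy (dy u) x y \<ge> \<beta> + \<delta>" for x y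
      using lap[of x y] by (simp add: laplacian_def distrib_left)
    show "\<bar>s * dx v x y\<bar> \<le> B" "\<bar>s * dy v x y\<bar> \<le> C" for x y using B C ss by (simp_all add: abs_mult)
    show "decays_in_y ?V"
      using assms(8) s by (auto simp: decays_in_y_def intro: tendsto_minus_cancel)
  qed (use assms \<delta> in auto)
  then show ?thesis using s by (auto simp: shear_flow_def)
qed

end
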